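(* Suppose $G\in\mathcal D_{(SL)}$ solves (i.e. is a minimizer of) the optimization problem $$\min_G\ \mathrm{Trace}\left(\begin{bmatrix}B\\ G\end{bmatrix}^T\mathcal M(G)\begin{bmatrix}B\\ G\end{bmatrix}\right)\quad\text{s.t.}\quad\sigma(S-GL)\subset\mathbb C^-,$$ where $\mathcal M(G)$ is the unique solution of $$\begin{bmatrix}A&0\\ 0&S-GL\end{bmatrix}^T\mathcal M(G)+\mathcal M(G)\begin{bmatrix}A&0\\ 0&S-GL\end{bmatrix}+\begin{bmatrix}C^TC&-C^TC_V\\ -C_V^TC&C_V^TC_V\end{bmatrix}=0.$$ Then $$M_{12}^T(G)W_{12}(G)L^T+M_{22}(G)W_{22}(G)L^T=M_{12}^T(G)B+M_{22}(G)G,$$ where $\mathcal W(G)$ solves $$\begin{bmatrix}A&0\\ 0&S-GL\end{bmatrix}\mathcal W(G)+\mathcal W(G)\begin{bmatrix}A&0\\ 0&S-GL\end{bmatrix}^T+\begin{bmatrix}B\\ G\end{bmatrix}\begin{bmatrix}B\\ G\end{bmatrix}^T=0.$$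
   Context: Let $A\in\mathbb R^{n\times n}$, $B\in\mathbb R^{n\times m}$, $C\in\mathbb R^{p\times n}$ be a minimal realization of a linear time-invariant system $\dot x=Ax+Bu$, $y=Cx$, with $A$ stable: $\sigma(A)\subset\mathbb C^-$ ($\sigma$ is the spectrum, $\mathbb C^-$ the open left half plane). Fix $S\in\mathbb R^{\nu\times\nu}$ and $L\in\mathbb R^{m\times\nu}$ with the pair $(L,S)$ observable and $\sigma(S)\cap\sigma(A)=\emptyset$, let $\Pi\in\mathbb R^{n\times\nu}$ be the unique solution of the Sylvester equation $A\Pi+BL=\Pi S$, and put $C_V=C\Pi$. The variable is $G\in\mathbb R^{\nu\times m}$ and $\mathcal D_{(SL)}=\{G:\sigma(S-GL)\subset\mathbb C^-\}$. Symmetric $(n+\nu)\times(n+\nu)$ matrices are partitioned as $\mathcal W=\begin{bmatrix}W_{11}&W_{12}\\ W_{12}^T&W_{22}\end{bmatrix}$, $\mathcal M=\begin{bmatrix}M_{11}&M_{12}\\ M_{12}^T&M_{22}\end{bmatrix}$ with $W_{11},M_{11}\in\mathbb R^{n\times n}$ and $W_{22},M_{22}\in\mathbb R^{\nu\times\nu}$. *)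

theory Defs
  imports "HOL-Analysis.Analysis"
begin

definition cmat :: "real ^ 'n ^ 'm \<Rightarrow> complex ^ 'n ^ 'm" where
  "cmat A = map_matrix complex_of_real A"

definition spectrum :: "real ^ 'n ^ 'n \<Rightarrow> complex set" where
  "spectrum A = {z. \<exists>v. v \<noteq> 0 \<and> cmat A *v v = z *s v}"

abbreviation open_left_half_plane :: "complex set" (\<open>\<complex>\<^sup>-\<close>) where
  "\<complex>\<^sup>- \<equiv> {z. Re z < 0}"

text \<open>The system \<open>x' = S x\<close>, \<open>y = L x\<close> on \<open>[0, \<infinity>)\<close>: the output determines the initial state.\<close>

definition observable :: "real ^ 'v ^ 'm \<Rightarrow> real ^ 'v ^ 'v \<Rightarrow> bool" where
  "observable L S \<longleftrightarrow>
    (\<forall>x y :: real \<Rightarrow> real ^ 'v.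
      (\<forall>t\<ge>0. (x has_vector_derivative S *v x t) (at t within {0..})) \<and>
      (\<forall>t\<ge>0. (y has_vector_derivative S *v y t) (at t within {0..})) \<and>
      (\<forall>t\<ge>0. L *v x t = L *v y t)
      \<longrightarrow> x 0 = y 0)"

definition transfer_function ::
  "real ^ 'n ^ 'n \<Rightarrow> real ^ 'm ^ 'n \<Rightarrow> real ^ 'n ^ 'p \<Rightarrow> complex \<Rightarrow> complex ^ 'm ^ 'p" where
  "transfer_function A B C s = cmat C ** matrix_inv (mat s - cmat A) ** cmat B"

text \<open>
  Minimality of the state dimension: no system with fewer than \<open>CARD('n)\<close> states has the same
  transfer function.  A system with \<open>r < CARD('n)\<close> states is encoded, up to renaming the states,
  by matrices over \<open>'n\<close> that vanish outside a set \<open>J\<close> of \<open>r\<close> indices; this zero padding leaves the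
  transfer function unchanged except that \<open>0\<close> is added to the spectrum, and excluding one further
  point does not affect equality of rational functions.  The case \<open>r = 0\<close> (zero transfer function)
  is \<open>J = {}\<close>.
\<close>

definition minimal_realization ::
  "real ^ 'n ^ 'n \<Rightarrow> real ^ 'm ^ 'n \<Rightarrow> real ^ 'n ^ 'p \<Rightarrow> bool" where
  "minimal_realization A B C \<longleftrightarrow>
    \<not> (\<exists>(J :: 'n set) A' B' C'.
        J \<noteq> UNIV \<and>
        (\<forall>i j. i \<notin> J \<or> j \<notin> J \<longrightarrow> A' $ i $ j = 0) \<and>
        (\<forall>i k. i \<notin> J \<longrightarrow> B' $ i $ k = 0) \<and>
        (\<forall>l j. j \<notin> J \<longrightarrow> C' $ l $ j = 0) \<and>
        (\<forall>s. s \<notin> spectrum A \<union> spectrum A' \<longrightarrow>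
          transfer_function A' B' C' s = transfer_function A B C s))"

definition block_mat ::
  "'a ^ 'n ^ 'm \<Rightarrow> 'a ^ 'v ^ 'm \<Rightarrow> 'a ^ 'n ^ 'w \<Rightarrow> 'a ^ 'v ^ 'w \<Rightarrow> 'a ^ ('n + 'v) ^ ('m + 'w)" where
  "block_mat P Q R T = (\<chi> i j.
    case i of
      Inl a \<Rightarrow> (case j of Inl b \<Rightarrow> P $ a $ b | Inr b \<Rightarrow> Q $ a $ b)
    | Inr a \<Rightarrow> (case j of Inl b \<Rightarrow> R $ a $ b | Inr b \<Rightarrow> T $ a $ b))"

definition block_col :: "'a ^ 'k ^ 'm \<Rightarrow> 'a ^ 'k ^ 'w \<Rightarrow> 'a ^ 'k ^ ('m + 'w)" where
  "block_col P Q = (\<chi> i j. case i of Inl a \<Rightarrow> P $ a $ j | Inr a \<Rightarrow> Q $ a $ j)"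

definition block12 :: "'a ^ ('n::finite + 'v::finite) ^ ('m::finite + 'w::finite) \<Rightarrow> 'a ^ 'v ^ 'm" where
  "block12 M = (\<chi> i j. M $ Inl i $ Inr j)"

definition block22 :: "'a ^ ('n::finite + 'v::finite) ^ ('m::finite + 'w::finite) \<Rightarrow> 'a ^ 'v ^ 'w" where
  "block22 M = (\<chi> i j. M $ Inr i $ Inr j)"

definition D_SL :: "real ^ 'v ^ 'v \<Rightarrow> real ^ 'v ^ 'm \<Rightarrow> (real ^ 'm ^ 'v) set" where
  "D_SL S L = {G. spectrum (S - G ** L) \<subseteq> \<complex>\<^sup>-}"

definition err_A ::
  "real ^ 'n ^ 'n \<Rightarrow> real ^ 'v ^ 'v \<Rightarrow> real ^ 'v ^ 'm \<Rightarrow> real ^ 'm ^ 'v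
    \<Rightarrow> real ^ ('n + 'v) ^ ('n + 'v)" where
  "err_A A S L G = block_mat A 0 0 (S - G ** L)"

text \<open>
  For \<open>A\<close> stable and \<open>G \<in> D_SL S L\<close> the matrix \<open>err_A A S L G\<close> is stable, so the Lyapunov equation
  below has exactly one solution; other values of \<open>G\<close> are irrelevant.
\<close>

definition gramian_M ::
  "real ^ 'n ^ 'n \<Rightarrow> real ^ 'n ^ 'p \<Rightarrow> real ^ 'v ^ 'v \<Rightarrow> real ^ 'v ^ 'm \<Rightarrow> real ^ 'v ^ 'p
    \<Rightarrow> real ^ 'm ^ 'v \<Rightarrow> real ^ ('n + 'v) ^ ('n + 'v)" where
  "gramian_M A C S L C\<^sub>V G = (THE M.
     transpose (err_A A S L G) ** M + M ** err_A A S L G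
     + block_mat (transpose C ** C) (- (transpose C ** C\<^sub>V))
                 (- (transpose C\<^sub>V ** C)) (transpose C\<^sub>V ** C\<^sub>V) = 0)"

definition objective ::
  "real ^ 'n ^ 'n \<Rightarrow> real ^ 'm ^ 'n \<Rightarrow> real ^ 'n ^ 'p \<Rightarrow> real ^ 'v ^ 'v \<Rightarrow> real ^ 'v ^ 'm
    \<Rightarrow> real ^ 'v ^ 'p \<Rightarrow> real ^ 'm ^ 'v \<Rightarrow> real" where
  "objective A B C S L C\<^sub>V G =
     trace (transpose (block_col B G) ** gramian_M A C S L C\<^sub>V G ** block_col B G)"

end

theory Submission
  imports Defs "HOL-Computational_Algebra.Fundamental_Theorem_Algebra"
begin

text \<open>
  Write \<open>F\<close> for the block diagonal error matrix at \<open>G\<close>, \<open>b\<close> for the stacked input matrix and \<open>Q\<close> for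
  the constant term of the equation for \<open>M\<close>.  Perturbing \<open>G\<close> to \<open>G + t D\<close> turns \<open>F\<close> and \<open>b\<close> into
  \<open>F + t E\<close> and \<open>b + t d\<close>.  Pairing the equation for the perturbed Gramian \<open>M\<^sub>t\<close> with the unperturbed
  \<open>W\<close> gives the exact identity
  \<open>f (G + t D) = trace (Q W) + t trace (M\<^sub>t X) + t\<^sup>2 trace (M\<^sub>t d d\<^sup>T)\<close> with
  \<open>X = E W + W E\<^sup>T + d b\<^sup>T + b d\<^sup>T\<close>, so only the continuity of \<open>M\<^sub>t\<close> at \<open>t = 0\<close> is needed, not its
  derivative.  Minimality yields \<open>trace (M X) \<ge> 0\<close>; this is linear in \<open>D\<close>, namely
  \<open>2 trace (D R\<^sup>T)\<close> with \<open>R\<close> the right side of the claim minus the left one, and \<open>D = - R\<close> forces \<open>R = 0\<close>.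
\<close>

section \<open>Matrix algebra and traces\<close>

lemma matrix_scaleR_left: "(r *\<^sub>R A) ** B = r *\<^sub>R ((A :: 'a::real_algebra_1 ^ 'n ^ 'm) ** B)"
  and matrix_scaleR_right: "A ** (r *\<^sub>R B) = r *\<^sub>R ((A :: 'a::real_algebra_1 ^ 'n ^ 'm) ** B)"
  by (simp_all add: matrix_matrix_mult_def vec_eq_iff scaleR_sum_right)

lemma matrix_uminus_left: "(- A) ** B = - ((A :: 'a::ring_1 ^ 'n ^ 'm) ** B)"
  and matrix_uminus_right: "A ** (- B) = - ((A :: 'a::ring_1 ^ 'n ^ 'm) ** B)"
  by (simp_all add: matrix_matrix_mult_def vec_eq_iff sum_negf)

lemma matrix_add_rdistrib: "(A + D) ** B = (A :: 'a::semiring_1 ^ 'n ^ 'm) ** B + D ** B"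
  by (simp add: matrix_matrix_mult_def vec_eq_iff sum.distrib algebra_simps)

lemma matrix_diff_ldistrib: "A ** (B - C) = (A :: 'a::ring_1 ^ 'n ^ 'm) ** B - A ** C"
  and matrix_diff_rdistrib: "(A - D) ** B = (A :: 'a::ring_1 ^ 'n ^ 'm) ** B - D ** B"
  by (simp_all add: matrix_matrix_mult_def vec_eq_iff sum_subtractf algebra_simps)

lemma matrix_mult_zero_left [simp]: "0 ** B = (0 :: 'a::semiring_1 ^ 'n ^ 'm)"
  and matrix_mult_zero_right [simp]: "A ** 0 = (0 :: 'a::semiring_1 ^ 'n ^ 'm)"
  by (simp_all add: matrix_matrix_mult_def vec_eq_iff)

lemmas matrix_distrib = matrix_add_ldistrib matrix_add_rdistrib matrix_diff_ldistrib
  matrix_diff_rdistrib matrix_uminus_left matrix_uminus_right matrix_scaleR_left matrix_scaleR_right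

lemma transpose_add: "transpose (A + B) = transpose A + transpose B"
  and transpose_diff: "transpose (A - B) = transpose A - transpose B"
  and transpose_uminus: "transpose (- A) = - transpose A"
  and transpose_zero [simp]: "transpose 0 = 0"
  by (simp_all add: transpose_def vec_eq_iff)

lemmas transpose_simps = transpose_add transpose_diff transpose_uminus
  transpose_scalar matrix_transpose_mul

lemma trace_scaleR: "trace (r *\<^sub>R A) = r * trace (A :: real ^ 'n ^ 'n)"
  and trace_uminus: "trace (- A) = - trace (A :: real ^ 'n ^ 'n)"
  by (simp_all add: trace_def sum_distrib_left sum_negf)

lemma trace_transpose: "trace (transpose A) = trace A"
  by (simp add: trace_def transpose_def)

lemma trace_mult_transpose_self: "trace (A ** transpose A) = (norm (A :: real ^ 'n ^ 'm))\<^sup>2"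
  unfolding power2_norm_eq_inner
  by (simp add: trace_def matrix_matrix_mult_def transpose_def inner_vec_def)

section \<open>Uniqueness for Sylvester and Lyapunov equations\<close>

text \<open>On matrices \<open>*s\<close> would take a row vector as its scalar and
  \<open>*\<^sub>R\<close> a real number, so complex multiples are formed entrywise.\<close>

abbreviation cscale :: "complex \<Rightarrow> complex ^ 'n ^ 'm \<Rightarrow> complex ^ 'n ^ 'm" where
  "cscale c \<equiv> map_matrix ((*) c)"

lemma cscale_mult_left: "cscale c A ** B = cscale c (A ** B)"
  and cscale_mult_right: "A ** cscale c B = cscale c (A ** B)"
  by (simp_all add: matrix_matrix_mult_def vec_eq_iff sum_distrib_left mult_ac)

lemma cscale_add: "cscale c (A + B) = cscale c A + cscale c B"
  and cscale_add_scalar: "cscale (c + d) A = cscale c A + cscale d A"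
  and cscale_cscale: "cscale c (cscale d A) = cscale (c * d) A"
  and cscale_zero [simp]: "cscale 0 A = 0" "cscale c 0 = 0"
  by (simp_all add: vec_eq_iff algebra_simps)

lemma cscale_of_real: "cscale (of_real r) A = r *\<^sub>R A"
  by (simp add: vec_eq_iff scaleR_conv_of_real[where 'a = complex])

text \<open>This is p(N) X by Horner's scheme, for a possibly rectangular X.\<close>

definition poly_apply ::
  "complex ^ 'n ^ 'n \<Rightarrow> complex ^ 'm ^ 'n \<Rightarrow> complex poly \<Rightarrow> complex ^ 'm ^ 'n" where
  "poly_apply N X p = fold_coeffs (\<lambda>a Y. cscale a X + N ** Y) p 0"

lemma poly_apply_0 [simp]: "poly_apply N X 0 = 0"
  by (simp add: poly_apply_def)

lemma poly_apply_pCons: "poly_apply N X (pCons a p) = cscale a X + N ** poly_apply N X p"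
  by (cases "p = 0 \<and> a = 0") (auto simp: poly_apply_def)

lemma poly_apply_add: "poly_apply N X (p + q) = poly_apply N X p + poly_apply N X q"
proof (induction p arbitrary: q)
  case (pCons a p)
  show ?case
    by (cases q) (simp add: pCons.IH poly_apply_pCons cscale_add_scalar matrix_add_ldistrib)
qed simp

lemma poly_apply_smult: "poly_apply N X (smult c p) = cscale c (poly_apply N X p)"
  by (induction p)
    (simp_all add: poly_apply_pCons cscale_add cscale_cscale cscale_mult_right)

lemma poly_apply_linear_factor:
  "poly_apply N X ([:-z, 1:] * q) = N ** poly_apply N X q - cscale z (poly_apply N X q)"
proof -
  have "[:-z, 1:] * q = pCons 0 q + smult (-z) q"
    by simp
  moreover have "cscale (-z) Y = - cscale z Y" for Y :: "complex ^ 'm ^ 'n"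
    by (simp add: vec_eq_iff)
  ultimately show ?thesis
    by (simp only: poly_apply_add poly_apply_smult poly_apply_pCons) simp
qed

lemma poly_apply_monom: "poly_apply N X (monom a i) = cscale a (((**) N ^^ i) X)"
  by (induction i) (simp_all add: monom_0 monom_Suc poly_apply_pCons cscale_mult_right)

lemma poly_apply_sum: "poly_apply N X (\<Sum>i\<in>I. f i) = (\<Sum>i\<in>I. poly_apply N X (f i))"
  by (induction I rule: infinite_finite_induct) (simp_all add: poly_apply_add)

text \<open>N commutes with p(N), so p(N) can be applied from the left to the whole
  equation.\<close>

lemma sylvester_poly_apply:
  assumes "N ** X + X ** K = 0"
  shows "N ** poly_apply N X p + poly_apply N X p ** K = 0"
proof (induction p)
  case (pCons a p)
  have "N ** poly_apply N X (pCons a p) + poly_apply N X (pCons a p) ** K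
      = cscale a (N ** X + X ** K) + N ** (N ** poly_apply N X p + poly_apply N X p ** K)"
    by (simp add: poly_apply_pCons matrix_distrib cscale_mult_left cscale_mult_right cscale_add
        matrix_mul_assoc)
  then show ?case
    by (simp add: assms pCons.IH)
qed simp

text \<open>Dependence is a property of sets, so a repeated value needs its own case: coefficients 1
  and -1 at two indices with equal values.\<close>

lemma finite_family_dependent:
  fixes f :: "nat \<Rightarrow> 'a::euclidean_space"
  obtains u where "\<exists>i\<le>DIM('a). u i \<noteq> 0" "(\<Sum>i\<le>DIM('a). u i *\<^sub>R f i) = 0"
proof (cases "inj_on f {..DIM('a)}")
  case True
  have "card (f ` {..DIM('a)}) > DIM('a)"
    using True by (simp add: card_image)
  then have "dependent (f ` {..DIM('a)})"
    by (intro dependent_biggerset) auto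
  then obtain v where v: "\<exists>x\<in>f ` {..DIM('a)}. v x \<noteq> 0"
    "(\<Sum>x\<in>f ` {..DIM('a)}. v x *\<^sub>R x) = 0"
    by (auto simp: dependent_finite)
  show ?thesis
    by (rule that[of "v \<circ> f"]) (use v True in \<open>auto simp: sum.reindex\<close>)
next
  case False
  then obtain i j where ij: "i \<le> DIM('a)" "j \<le> DIM('a)" "i \<noteq> j" "f i = f j"
    by (auto simp: inj_on_def)
  define u :: "nat \<Rightarrow> real" where "u k = (if k = i then 1 else if k = j then -1 else 0)" for k
  have "(\<Sum>k\<le>DIM('a). u k *\<^sub>R f k) = (\<Sum>k\<in>{i, j}. u k *\<^sub>R f k)"
    by (rule sum.mono_neutral_right) (use ij in \<open>auto simp: u_def\<close>)
  also have "\<dots> = 0"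
    using ij by (simp add: u_def)
  finally show ?thesis
    by (intro that[of u]) (use ij in \<open>auto simp: u_def intro: exI[of _ i]\<close>)
qed

text \<open>The matrices X, N X, N^2 X, ... lie in a real vector space of finite dimension; the
  coefficients of a linear relation among them are those of p.\<close>

lemma annihilating_poly_exists:
  obtains p where "p \<noteq> 0" "poly_apply N X p = 0"
proof -
  let ?D = "DIM(complex ^ 'a ^ 'b)"
  obtain u where u: "\<exists>i\<le>?D. u i \<noteq> 0" "(\<Sum>i\<le>?D. u i *\<^sub>R ((**) N ^^ i) X) = 0"
    by (rule finite_family_dependent[of "\<lambda>i. ((**) N ^^ i) X"])
  define p where "p = (\<Sum>i\<le>?D. monom (complex_of_real (u i)) i)"
  have coeff: "coeff p i = (if i \<le> ?D then of_real (u i) else 0)" for i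
    by (simp add: p_def coeff_sum)
  have "p \<noteq> 0"
    using u(1) coeff by (metis coeff_0 of_real_eq_0_iff)
  moreover have "poly_apply N X p = 0"
    using u(2) by (simp add: p_def poly_apply_sum poly_apply_monom cscale_of_real)
  ultimately show ?thesis
    by (rule that)
qed

text \<open>
  If \<open>N X = - X K\<close>, then also \<open>N Y = - Y K\<close> for \<open>Y = q(N) X\<close>.  Removing roots one by one from a
  polynomial that annihilates \<open>X\<close> leads to such a \<open>Y \<noteq> 0\<close> with \<open>N Y = z Y\<close>, whence \<open>Y K = - z Y\<close>:
  the columns of \<open>Y\<close> are eigenvectors of \<open>N\<close> and its rows left eigenvectors of \<open>K\<close>.
\<close>

lemma sylvester_eigen_matrix:
  assumes "N ** X + X ** K = 0" "X \<noteq> 0" "p \<noteq> 0" "poly_apply N X p = 0"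
  shows "\<exists>z Y. Y \<noteq> 0 \<and> N ** Y = cscale z Y \<and> Y ** K = - cscale z Y"
  using assms(3,4)
proof (induction "degree p" arbitrary: p)
  case 0
  then obtain a where "p = [:a:]" "a \<noteq> 0"
    by (metis degree_eq_zeroE pCons_0_0)
  then have "cscale a X = 0"
    using 0 by (simp add: poly_apply_pCons)
  with \<open>a \<noteq> 0\<close> \<open>X \<noteq> 0\<close> show ?case
    by (simp add: vec_eq_iff)
next
  case (Suc n)
  then have "\<not> constant (poly p)"
    by (simp add: constant_degree)
  then obtain z where "poly p z = 0"
    using fundamental_theorem_of_algebra by blast
  then obtain q where q: "p = [:-z, 1:] * q"
    by (auto simp: poly_eq_0_iff_dvd)
  with Suc.prems have "q \<noteq> 0"
    by auto
  then have "degree p = Suc (degree q)"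
    unfolding q by (subst degree_mult_eq) auto
  with Suc.hyps(2) have "degree q = n"
    by simp
  let ?Y = "poly_apply N X q"
  show ?case
  proof (cases "?Y = 0")
    case True
    with Suc.hyps(1) \<open>q \<noteq> 0\<close> \<open>degree q = n\<close> show ?thesis
      by blast
  next
    case False
    have "N ** ?Y = cscale z ?Y"
      using Suc.prems(2) unfolding q poly_apply_linear_factor by simp
    moreover from this have "?Y ** K = - cscale z ?Y"
      using sylvester_poly_apply[OF assms(1), of q] by (metis add_eq_0_iff)
    ultimately show ?thesis
      using False by blast
  qed
qed

lemma sylvester_eigenvectors:
  fixes N :: "complex ^ 'n ^ 'n" and K :: "complex ^ 'm ^ 'm" and X :: "complex ^ 'm ^ 'n"
  assumes "N ** X + X ** K = 0" "X \<noteq> 0"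
  obtains z u w where "u \<noteq> 0" "N *v u = z *s u" "w \<noteq> 0" "transpose K *v w = (- z) *s w"
proof -
  obtain p where "p \<noteq> 0" "poly_apply N X p = 0"
    by (rule annihilating_poly_exists)
  from sylvester_eigen_matrix[OF assms this] obtain z Y
    where Y: "Y \<noteq> 0" "N ** Y = cscale z Y" "Y ** K = - cscale z Y"
    by blast
  \<comment> \<open>One nonzero entry makes both its column and its row nonzero.\<close>
  from \<open>Y \<noteq> 0\<close> obtain i j where ij: "Y $ i $ j \<noteq> 0"
    by (auto simp: vec_eq_iff)
  show ?thesis
  proof (rule that)
    show "column j Y \<noteq> 0" "row i Y \<noteq> 0"
      using ij by (auto simp: column_def row_def vec_eq_iff)
    show "N *v column j Y = z *s column j Y"
      using Y(2) by (simp add: column_def matrix_vector_mult_def matrix_matrix_mult_def vec_eq_iff)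
    show "transpose K *v row i Y = (- z) *s row i Y"
      using Y(3) unfolding matrix_vector_mult_def matrix_matrix_mult_def vec_eq_iff
      by (simp add: row_def transpose_def mult.commute)
  qed
qed

section \<open>Complexification and spectra of real matrices\<close>

lemma cmat_mult: "cmat (A ** B) = cmat A ** cmat B"
  by (simp add: cmat_def matrix_matrix_mult_def vec_eq_iff)

lemma cmat_add: "cmat (A + B) = cmat A + cmat B"
  and cmat_transpose: "cmat (transpose A) = transpose (cmat A)"
  and cmat_scaleR: "cmat (r *\<^sub>R A) = r *\<^sub>R cmat A"
  and cmat_eq_0_iff: "cmat A = 0 \<longleftrightarrow> A = 0"
  by (simp_all add: cmat_def transpose_def vec_eq_iff scaleR_conv_of_real[where 'a = complex])

text \<open>Invertibility is seen by the determinant and hence survives transposition, which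
  eigenvectors do not; \<open>spectrum_transpose\<close> relies on this.\<close>

lemma spectrum_iff_not_invertible: "z \<in> spectrum A \<longleftrightarrow> \<not> invertible (cmat A - mat z)"
proof -
  have "mat z *v v = z *s v" for v :: "complex ^ 'a"
    by (simp add: matrix_vector_mult_def mat_def vec_eq_iff if_distrib[of "\<lambda>x. x * _"] cong: if_cong)
  then show ?thesis
    by (auto simp: spectrum_def invertible_left_inverse matrix_left_invertible_ker
        matrix_vector_mult_diff_rdistrib)
qed

lemma spectrum_transpose: "spectrum (transpose A) = spectrum A"
proof -
  have "cmat (transpose A) - mat z = transpose (cmat A - mat z)" for z
    by (simp add: cmat_transpose transpose_diff)
  then have "invertible (cmat (transpose A) - mat z) \<longleftrightarrow> invertible (cmat A - mat z)" for z
    by (simp add: invertible_det_nz)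
  then show ?thesis
    by (auto simp: spectrum_iff_not_invertible)
qed

text \<open>A nonzero solution would produce z in the spectrum of N with -z in that of K, but z and
  -z cannot both have negative real part.\<close>

lemma sylvester_stable_unique:
  fixes N :: "real ^ 'n ^ 'n" and K :: "real ^ 'm ^ 'm" and X :: "real ^ 'm ^ 'n"
  assumes "spectrum N \<subseteq> \<complex>\<^sup>-" "spectrum K \<subseteq> \<complex>\<^sup>-" and eq: "N ** X + X ** K = 0"
  shows "X = 0"
proof (rule ccontr)
  assume "X \<noteq> 0"
  then have "cmat X \<noteq> 0"
    by (simp add: cmat_eq_0_iff)
  moreover have "cmat N ** cmat X + cmat X ** cmat K = 0"
    using eq by (simp flip: cmat_mult cmat_add add: cmat_eq_0_iff)
  ultimately obtain z u w where "u \<noteq> 0" "cmat N *v u = z *s u" "w \<noteq> 0"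
    "transpose (cmat K) *v w = (- z) *s w"
    by (metis sylvester_eigenvectors)
  then have "z \<in> spectrum N" "- z \<in> spectrum (transpose K)"
    unfolding spectrum_def cmat_transpose by blast+
  with assms(1,2) show False
    by (force simp: spectrum_transpose)
qed

section \<open>Lyapunov equations with stable coefficient\<close>

lemma lyapunov_stable_unique:
  fixes F :: "real ^ 'n ^ 'n"
  assumes "spectrum F \<subseteq> \<complex>\<^sup>-" "transpose F ** X + X ** F = transpose F ** Y + Y ** F"
  shows "X = Y"
  using sylvester_stable_unique[of "transpose F" F "X - Y"] assms
  by (simp add: spectrum_transpose matrix_distrib algebra_simps)

lemma linear_lyapunov: "linear (\<lambda>X. transpose F ** X + X ** (F :: real ^ 'n ^ 'n))"
  by (rule linearI) (simp_all add: matrix_distrib algebra_simps)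

lemma inj_lyapunov:
  fixes F :: "real ^ 'n ^ 'n"
  assumes "spectrum F \<subseteq> \<complex>\<^sup>-"
  shows "inj (\<lambda>X. transpose F ** X + X ** F)"
  by (rule injI, rule lyapunov_stable_unique[OF assms])

text \<open>An injective linear endomorphism of a finite-dimensional space is onto, so uniqueness
  already yields existence.\<close>

lemma lyapunov_stable_solution_unique:
  fixes F :: "real ^ 'n ^ 'n"
  assumes "spectrum F \<subseteq> \<complex>\<^sup>-"
  shows "\<exists>!M. transpose F ** M + M ** F + Q = 0"
proof -
  have "surj (\<lambda>X. transpose F ** X + X ** F)"
    by (rule linear_injective_imp_surjective[OF linear_lyapunov inj_lyapunov[OF assms]]) simp
  from surjD[OF this, of "- Q"] obtain M where M: "transpose F ** M + M ** F = - Q"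
    by auto
  show ?thesis
  proof (rule ex1I[of _ M])
    show "transpose F ** M + M ** F + Q = 0"
      by (simp add: M)
    show "N = M" if "transpose F ** N + N ** F + Q = 0" for N
    proof (rule lyapunov_stable_unique[OF assms])
      show "transpose F ** N + N ** F = transpose F ** M + M ** F"
        using that unfolding M by (simp only: eq_neg_iff_add_eq_0)
    qed
  qed
qed

text \<open>Transposing the equation shows that \<open>transpose M\<close> solves it too.\<close>

lemma lyapunov_symmetric:
  fixes F :: "real ^ 'n ^ 'n"
  assumes "spectrum F \<subseteq> \<complex>\<^sup>-" "transpose F ** M + M ** F + Q = 0" "transpose Q = Q"
  shows "transpose M = M"
proof -
  have "transpose (transpose F ** M + M ** F + Q) = 0"
    by (simp add: assms(2))
  then have "transpose F ** transpose M + transpose M ** F + Q = 0"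
    using assms(3) by (simp add: transpose_simps algebra_simps)
  with assms(2) have "transpose F ** transpose M + transpose M ** F + Q
      = transpose F ** M + M ** F + Q"
    by simp
  then have "transpose F ** transpose M + transpose M ** F = transpose F ** M + M ** F"
    by (rule add_right_imp_eq)
  then show ?thesis
    by (rule lyapunov_stable_unique[OF assms(1)])
qed

section \<open>Perturbation of stable matrices\<close>

lemma norm_vector_scalar_mult: "norm (z *s v) = cmod z * norm (v :: complex ^ 'n)"
  by (simp add: norm_vec_def norm_mult L2_set_right_distrib)

lemma matrix_vector_mult_scaleR_left: "(r *\<^sub>R A) *v v = r *\<^sub>R ((A :: 'a::real_algebra_1 ^ 'n ^ 'm) *v v)"
  by (simp add: matrix_vector_mult_def vec_eq_iff scaleR_sum_right)

text \<open>A compactness argument: F v - z v stays away from 0 for unit v and bounded z in the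
  closed right half plane, while an eigenpair of F + t E makes its norm at most t b.\<close>

lemma stable_perturbation:
  fixes F E :: "real ^ 'n ^ 'n"
  assumes "spectrum F \<subseteq> \<complex>\<^sup>-"
  shows "\<forall>\<^sub>F t in at_right (0::real). spectrum (F + t *\<^sub>R E) \<subseteq> \<complex>\<^sup>-"
proof -
  obtain a where a: "a > 0" "\<And>v. norm (cmat F *v v) \<le> a * norm v"
    by (rule linear_bounded_pos[OF matrix_vector_mul_linear[of "cmat F"]]) (rule that)
  obtain b where b: "b > 0" "\<And>v. norm (cmat E *v v) \<le> b * norm v"
    by (rule linear_bounded_pos[OF matrix_vector_mul_linear[of "cmat E"]]) (rule that)
  \<comment> \<open>For t < 1 every eigenvalue of F + t E has modulus at most a + b, which cuts the
    half plane down to a compact set.\<close>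
  define T :: "(complex \<times> (complex ^ 'n)) set"
    where "T = (cball 0 (a + b) \<inter> {z. Re z \<ge> 0}) \<times> sphere 0 1"
  define g where "g = (\<lambda>(z, v). cmat F *v v - z *s v)"
  have "compact T"
    unfolding T_def
    by (intro compact_Times compact_Int_closed compact_cball compact_sphere closed_halfspace_Re_ge)
  moreover have "continuous_on T g"
  proof -
    have "continuous_on T (\<lambda>p. cmat F *v snd p)"
      by (intro linear_continuous_on_compose[OF _ matrix_vector_mul_linear] continuous_intros)
    moreover have "continuous_on T (\<lambda>p. fst p *s snd p)"
      unfolding vector_scalar_mult_def by (intro continuous_intros)
    ultimately show ?thesis
      unfolding g_def case_prod_unfold by (intro continuous_intros)
  qed
  ultimately have "closed (g ` T)"
    by (intro compact_imp_closed compact_continuous_image)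
  moreover have "0 \<notin> g ` T"
  proof
    assume "0 \<in> g ` T"
    then obtain z v where "(z, v) \<in> T" "cmat F *v v = z *s v"
      by (auto simp: g_def)
    then have "Re z \<ge> 0" "norm v = 1" "cmat F *v v = z *s v"
      unfolding T_def by auto
    moreover from this have "v \<noteq> 0"
      by auto
    ultimately have "z \<in> spectrum F"
      unfolding spectrum_def by blast
    with assms \<open>Re z \<ge> 0\<close> show False
      by auto
  qed
  ultimately obtain c where c: "c > 0" "\<And>y. y \<in> g ` T \<Longrightarrow> c \<le> norm y"
    using separate_point_closed[of "g ` T" 0] by auto
  \<comment> \<open>The bound 1 keeps the eigenpair inside \<open>T\<close>; the bound c / b gives t
    b < c, against the choice of c.\<close>
  have "spectrum (F + t *\<^sub>R E) \<subseteq> \<complex>\<^sup>-" if t: "0 < t" "t < min 1 (c / b)" for t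
  proof (rule ccontr)
    assume "\<not> ?thesis"
    then obtain z where "z \<in> spectrum (F + t *\<^sub>R E)" and z: "Re z \<ge> 0"
      by (auto simp: subset_iff not_less)
    then obtain v0 where v0: "v0 \<noteq> 0" "cmat (F + t *\<^sub>R E) *v v0 = z *s v0"
      unfolding spectrum_def by blast
    define v where "v = (1 / norm v0) *\<^sub>R v0"
    have v: "norm v = 1"
      using v0 by (simp add: v_def)
    have "cmat (F + t *\<^sub>R E) *v v = z *s v"
    proof -
      have "cmat (F + t *\<^sub>R E) *v v = (1 / norm v0) *\<^sub>R (cmat (F + t *\<^sub>R E) *v v0)"
        by (simp add: v_def linear_scale[OF matrix_vector_mul_linear])
      moreover have "z *s v = (1 / norm v0) *\<^sub>R (z *s v0)"
        by (simp add: v_def vec_eq_iff)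
      ultimately show ?thesis
        using v0(2) by simp
    qed
    then have eq: "cmat F *v v + t *\<^sub>R (cmat E *v v) = z *s v"
      by (simp add: cmat_add cmat_scaleR matrix_vector_mult_add_rdistrib
          matrix_vector_mult_scaleR_left)
    have E: "norm (t *\<^sub>R (cmat E *v v)) \<le> t * b"
      using b(2)[of v] v t by simp
    have "cmod z = norm (z *s v)"
      by (simp add: norm_vector_scalar_mult v)
    also have "\<dots> \<le> norm (cmat F *v v) + norm (t *\<^sub>R (cmat E *v v))"
      unfolding eq[symmetric] by (rule norm_triangle_ineq)
    also have "\<dots> \<le> a + t * b"
      using a(2)[of v] v E by simp
    also have "\<dots> \<le> a + b"
      using t b(1) by simp
    finally have "(z, v) \<in> T"
      using z v by (simp add: T_def)
    then have "c \<le> norm (g (z, v))"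
      by (intro c(2)) blast
    also have "g (z, v) = - (t *\<^sub>R (cmat E *v v))"
      using eq by (simp add: g_def algebra_simps)
    also have "norm \<dots> \<le> t * b"
      using E by simp
    also have "\<dots> < c"
      using t b(1) by (simp add: field_simps)
    finally show False
      by simp
  qed
  then show ?thesis
    unfolding eventually_at_right_field using b(1) c(1) by (intro exI[of _ "min 1 (c / b)"]) simp
qed

text \<open>Subtracting the two equations cancels Q and leaves a Lyapunov equation for
  \<open>N t - M\<close> whose right side carries a factor t; the lower bound c of the injective
  Lyapunov map then makes the difference O(t).\<close>

lemma lyapunov_solution_tendsto:
  fixes F E Q M :: "real ^ 'n ^ 'n" and N :: "real \<Rightarrow> real ^ 'n ^ 'n"
  assumes "spectrum F \<subseteq> \<complex>\<^sup>-" "transpose F ** M + M ** F + Q = 0"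
    and N: "\<forall>\<^sub>F t in at_right 0.
      transpose (F + t *\<^sub>R E) ** N t + N t ** (F + t *\<^sub>R E) + Q = 0"
  shows "(N \<longlongrightarrow> M) (at_right 0)"
proof -
  obtain c where c: "c > 0" "\<And>X. c * norm X \<le> norm (transpose F ** X + X ** F)"
    by (rule linear_inj_bounded_below_pos[OF linear_lyapunov inj_lyapunov[OF assms(1)]]) (rule that)
  obtain k where k: "k > 0" "\<And>X. norm (transpose E ** X + X ** E) \<le> k * norm X"
    by (rule linear_bounded_pos[OF linear_lyapunov[of E]]) (rule that)
  \<comment> \<open>With t k < c / 2 the error is at most half of \<open>norm (N t)\<close>, whence
    the a priori bound 2 \<open>norm M\<close> on \<open>norm (N t)\<close>.\<close>
  have small: "\<forall>\<^sub>F t in at_right (0::real). 0 < t \<and> t < c / (2 * k)"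
    using c(1) k(1) eventually_at_right_real[of 0 "c / (2 * k)"] by simp
  have "\<forall>\<^sub>F t in at_right 0. norm (N t - M) \<le> t * (2 * k * norm M / c)"
    using N small
  proof eventually_elim
    case (elim t)
    have "transpose F ** (N t - M) + (N t - M) ** F
        = - (t *\<^sub>R (transpose E ** N t + N t ** E))"
    proof -
      have "transpose F ** (N t - M) + (N t - M) ** F + t *\<^sub>R (transpose E ** N t + N t ** E)
        = (transpose (F + t *\<^sub>R E) ** N t + N t ** (F + t *\<^sub>R E) + Q)
          - (transpose F ** M + M ** F + Q)"
        by (simp add: transpose_simps matrix_distrib algebra_simps)
      also have "\<dots> = 0"
        using elim assms(2) by simp
      finally show ?thesis
        by (simp add: eq_neg_iff_add_eq_0)
    qed
    then have "c * norm (N t - M) \<le> t * norm (transpose E ** N t + N t ** E)"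
      using c(2)[of "N t - M"] elim by simp
    also have "\<dots> \<le> t * (k * norm (N t))"
      using elim k(2) by simp
    finally have 1: "c * norm (N t - M) \<le> t * k * norm (N t)"
      by simp
    have "t * k * norm (N t) \<le> c / 2 * norm (N t)"
      using elim k(1) by (intro mult_right_mono) (simp_all add: field_simps)
    with 1 have "norm (N t - M) \<le> norm (N t) / 2"
      using c(1) by (smt (verit) mult_le_cancel_left_pos times_divide_eq_left times_divide_eq_right)
    then have "norm (N t) \<le> 2 * norm M"
      using norm_triangle_sub[of "N t" M] by simp
    with k(1) elim have "t * k * norm (N t) \<le> t * k * (2 * norm M)"
      by (intro mult_left_mono) auto
    with 1 c(1) show ?case
      by (simp add: field_simps)
  qed
  moreover have "((\<lambda>t. t * (2 * k * norm M / c)) \<longlongrightarrow> 0) (at_right 0)"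
    by (rule tendsto_eq_intros tendsto_ident_at | simp)+
  ultimately have "((\<lambda>t. N t - M) \<longlongrightarrow> 0) (at_right 0)"
    by (rule Lim_null_comparison)
  then show ?thesis
    by (simp add: LIM_zero_iff)
qed


section \<open>First variation of the trace objective\<close>

text \<open>Under the trace pairing the Lyapunov maps of H and of its transpose are adjoint, so the
  operator moves from W to N, where the equation for N turns it into -Q.\<close>

lemma trace_lyapunov_expansion:
  fixes F E W N Q :: "real ^ 'k ^ 'k" and b d :: "real ^ 'm ^ 'k"
  assumes W: "F ** W + W ** transpose F + b ** transpose b = 0"
    and N: "transpose (F + t *\<^sub>R E) ** N + N ** (F + t *\<^sub>R E) + Q = 0"
  shows "trace (transpose (b + t *\<^sub>R d) ** N ** (b + t *\<^sub>R d)) = trace (Q ** W)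
    + t * (trace (N ** (E ** W + W ** transpose E + d ** transpose b + b ** transpose d))
      + t * trace (N ** (d ** transpose d)))"
proof -
  define H where "H = F + t *\<^sub>R E"
  define c where "c = b + t *\<^sub>R d"
  define X where "X = E ** W + W ** transpose E + d ** transpose b + b ** transpose d"
  have bb: "b ** transpose b = - (F ** W + W ** transpose F)"
    using W by (simp only: eq_neg_iff_add_eq_0 add.commute)
  \<comment> \<open>Here F is rewritten as H - t E, which contributes the E-terms of X.\<close>
  have c: "c ** transpose c = - (H ** W + W ** transpose H) + t *\<^sub>R X + (t * t) *\<^sub>R (d ** transpose d)"
    unfolding c_def H_def X_def by (simp add: transpose_simps matrix_distrib bb scaleR_add_right)
  have "trace (N ** (H ** W + W ** transpose H)) = trace ((transpose H ** N + N ** H) ** W)"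
    using trace_mul_sym[of "transpose H" "N ** W"]
    by (simp add: matrix_distrib trace_add matrix_mul_assoc)
  also have "transpose H ** N + N ** H = - Q"
    using N unfolding H_def by (simp only: eq_neg_iff_add_eq_0)
  finally have lyap: "trace (N ** (H ** W + W ** transpose H)) = - trace (Q ** W)"
    by (simp add: matrix_uminus_left trace_uminus)
  have "trace (transpose c ** N ** c) = trace (N ** (c ** transpose c))"
    using trace_mul_sym[of "transpose c" "N ** c"] by (simp add: matrix_mul_assoc)
  also have "\<dots> = - trace (N ** (H ** W + W ** transpose H)) + t * trace (N ** X)
      + t * t * trace (N ** (d ** transpose d))"
    unfolding c matrix_add_ldistrib[of N] matrix_uminus_right matrix_scaleR_right trace_add
      trace_uminus trace_scaleR ..
  finally show ?thesis
    unfolding lyap c_def X_def by (simp add: algebra_simps)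
qed

text \<open>The increase of the objective is t times a quantity that tends to the stated trace;
  minimality and t > 0 make that quantity nonnegative.\<close>

lemma trace_lyapunov_first_order:
  fixes F E W M Q :: "real ^ 'k ^ 'k" and b d :: "real ^ 'm ^ 'k"
    and N :: "real \<Rightarrow> real ^ 'k ^ 'k"
  assumes F: "spectrum F \<subseteq> \<complex>\<^sup>-"
    and W: "F ** W + W ** transpose F + b ** transpose b = 0"
    and M: "transpose F ** M + M ** F + Q = 0"
    and N: "\<forall>\<^sub>F t in at_right 0.
      transpose (F + t *\<^sub>R E) ** N t + N t ** (F + t *\<^sub>R E) + Q = 0"
    and min: "\<forall>\<^sub>F t in at_right 0. trace (transpose b ** M ** b)
      \<le> trace (transpose (b + t *\<^sub>R d) ** N t ** (b + t *\<^sub>R d))"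
  shows "0 \<le> trace (M ** (E ** W + W ** transpose E + d ** transpose b + b ** transpose d))"
proof -
  define X where "X = E ** W + W ** transpose E + d ** transpose b + b ** transpose d"
  \<comment> \<open>The expansion at t = 0 evaluates the unperturbed objective.\<close>
  have base: "trace (transpose b ** M ** b) = trace (Q ** W)"
    using trace_lyapunov_expansion[OF W, of 0 E M Q d] M by simp
  have lim: "(N \<longlongrightarrow> M) (at_right 0)"
    by (rule lyapunov_solution_tendsto[OF F M N])
  have "linear (\<lambda>Z. trace (Z ** Y))" for Y :: "real ^ 'k ^ 'k"
    by (rule linearI) (simp_all add: matrix_distrib trace_add trace_scaleR)
  then have tr: "((\<lambda>t. trace (N t ** Y)) \<longlongrightarrow> trace (M ** Y)) (at_right 0)" for Y
    by (rule bounded_linear.tendsto[OF iffD1[OF linear_conv_bounded_linear] lim])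
  have "((\<lambda>t. trace (N t ** X) + t * trace (N t ** (d ** transpose d)))
      \<longlongrightarrow> trace (M ** X) + 0 * trace (M ** (d ** transpose d))) (at_right 0)"
    by (intro tendsto_intros tr)
  moreover have "\<forall>\<^sub>F t in at_right 0.
      0 \<le> trace (N t ** X) + t * trace (N t ** (d ** transpose d))"
    using N min eventually_at_right_less[of 0]
  proof eventually_elim
    case (elim t)
    have "0 \<le> t * (trace (N t ** X) + t * trace (N t ** (d ** transpose d)))"
      using elim(2) unfolding base trace_lyapunov_expansion[OF W elim(1)] X_def by simp
    with elim(3) show ?case
      by (simp add: zero_le_mult_iff)
  qed
  ultimately have "0 \<le> trace (M ** X) + 0 * trace (M ** (d ** transpose d))"
    by (rule tendsto_lowerbound) (rule trivial_limit_at_right_real)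
  then show ?thesis
    unfolding X_def by simp
qed

text \<open>Transposition and cyclic rotation under the trace match the four terms in pairs.\<close>

lemma trace_symmetric_gradient:
  fixes E W M :: "real ^ 'k ^ 'k" and b d :: "real ^ 'm ^ 'k"
  assumes "transpose M = M" "transpose W = W"
  shows "trace (M ** (E ** W + W ** transpose E + d ** transpose b + b ** transpose d))
    = 2 * (trace (M ** E ** W) + trace (M ** d ** transpose b))"
proof -
  have 1: "trace (M ** W ** transpose E) = trace (M ** E ** W)"
    using trace_transpose[of "M ** W ** transpose E"] trace_mul_sym[of "E ** W" M]
    by (simp add: transpose_simps assms matrix_mul_assoc)
  have 2: "trace (M ** b ** transpose d) = trace (M ** d ** transpose b)"
    using trace_transpose[of "M ** b ** transpose d"] trace_mul_sym[of "d ** transpose b" M]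
    by (simp add: transpose_simps assms matrix_mul_assoc)
  show ?thesis
    by (simp add: matrix_distrib trace_add matrix_mul_assoc 1 2)
qed

section \<open>Block structure\<close>

lemma sum_UNIV_sum_type:
  "(\<Sum>x\<in>UNIV. f x) = (\<Sum>a\<in>UNIV. f (Inl a)) + (\<Sum>b\<in>UNIV. f (Inr b :: 'a::finite + 'b::finite))"
  by (simp flip: UNIV_Plus_UNIV add: sum.Plus)

text \<open>Both halves of an eigenvector satisfy the eigenvalue equation of their block, and at
  least one half is nonzero.\<close>

lemma spectrum_block_diag: "spectrum (block_mat A 0 0 D) \<subseteq> spectrum A \<union> spectrum D"
proof
  fix z
  assume "z \<in> spectrum (block_mat A 0 0 D)"
  then obtain v where v: "v \<noteq> 0" "cmat (block_mat A 0 0 D) *v v = z *s v"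
    unfolding spectrum_def by blast
  define v1 where "v1 = (\<chi> a. v $ Inl a)"
  define v2 where "v2 = (\<chi> a. v $ Inr a)"
  have "(cmat A *v v1) $ a = z * v1 $ a" for a
    using arg_cong[OF v(2), of "\<lambda>u. u $ Inl a"]
    by (simp add: matrix_vector_mult_def cmat_def block_mat_def sum_UNIV_sum_type v1_def)
  then have "cmat A *v v1 = z *s v1"
    by (simp add: vec_eq_iff)
  moreover have "(cmat D *v v2) $ a = z * v2 $ a" for a
    using arg_cong[OF v(2), of "\<lambda>u. u $ Inr a"]
    by (simp add: matrix_vector_mult_def cmat_def block_mat_def sum_UNIV_sum_type v2_def)
  then have "cmat D *v v2 = z *s v2"
    by (simp add: vec_eq_iff)
  moreover have "v1 \<noteq> 0 \<or> v2 \<noteq> 0"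
  proof -
    from v(1) obtain i where "v $ i \<noteq> 0"
      by (auto simp: vec_eq_iff)
    then show ?thesis
      by (cases i) (auto simp: v1_def v2_def vec_eq_iff)
  qed
  ultimately show "z \<in> spectrum A \<union> spectrum D"
    unfolding spectrum_def by blast
qed

lemma transpose_block_mat:
  "transpose (block_mat P Q R T) = block_mat (transpose P) (transpose R) (transpose Q) (transpose T)"
  by (simp add: transpose_def block_mat_def vec_eq_iff split: sum.split)

text \<open>
  The embedding of the second block: \<open>W ** inr_mat\<close> is the second block column of \<open>W\<close>.
\<close>

abbreviation inr_mat :: "real ^ 'v ^ ('n::finite + 'v)" where
  "inr_mat \<equiv> block_col 0 (mat 1)"

lemma inr_mat_mult_component [simp]:
  "(inr_mat ** X) $ Inl a $ j = 0" "(inr_mat ** X) $ Inr b $ j = X $ b $ j"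
  "(X' ** transpose inr_mat) $ j $ Inl a = 0" "(X' ** transpose inr_mat) $ j $ Inr b = X' $ j $ b"
  by (simp_all add: matrix_matrix_mult_def block_col_def mat_def transpose_def
      if_distrib[of "\<lambda>x. x * _"] if_distrib[of "\<lambda>x. _ * x"] cong: if_cong)

lemma inr_mat_conjugate: "inr_mat ** X ** transpose inr_mat = block_mat 0 0 0 X"
  unfolding vec_eq_iff
proof (intro allI)
  fix i j
  show "(inr_mat ** X ** transpose inr_mat) $ i $ j = block_mat 0 0 0 X $ i $ j"
    by (cases i; cases j) (simp_all add: block_mat_def)
qed

text \<open>Writing the change of the lower right block as a product with \<open>inr_mat\<close> on
  both sides allows D to be rotated out of a trace later.\<close>

lemma err_A_perturb:
  "err_A A S L (G + t *\<^sub>R D)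
    = err_A A S L G + t *\<^sub>R (- (inr_mat ** (D ** L) ** transpose inr_mat))"
  unfolding inr_mat_conjugate
  by (simp add: err_A_def block_mat_def vec_eq_iff matrix_distrib split: sum.split)

lemma block_col_perturb: "block_col B (G + t *\<^sub>R D) = block_col B G + t *\<^sub>R (inr_mat ** D)"
  by (simp add: block_col_def[of B] vec_eq_iff split: sum.split)

lemma mult_inr_mat:
  "W ** inr_mat = block_col (block12 W) (block22 W)"
  by (simp add: matrix_matrix_mult_def block_col_def block12_def block22_def vec_eq_iff
      sum_UNIV_sum_type mat_def if_distrib[of "\<lambda>x. _ * x"] cong: if_cong split: sum.split)

text \<open>By symmetry the lower block row of M is the transpose of its second block
  column.\<close>

lemma inr_mat_symmetric_mult:
  assumes "transpose M = M"
  shows "transpose inr_mat ** M ** block_col B G = transpose (block12 M) ** B + block22 M ** G"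
proof -
  have "transpose inr_mat ** M = transpose (block_col (block12 M) (block22 M))"
    by (simp add: transpose_simps assms flip: mult_inr_mat)
  moreover have "block22 M = transpose (block22 M)"
    using assms by (simp add: block22_def transpose_def vec_eq_iff)
  moreover have "transpose (block_col X Y) ** block_col B G = transpose X ** B + transpose Y ** G" for X Y
    by (simp add: matrix_matrix_mult_def transpose_def block_col_def vec_eq_iff sum_UNIV_sum_type)
  ultimately show ?thesis
    by metis
qed


section \<open>Stationarity of the minimizer over the stabilizing G\<close>

theorem lemma3p10:
  fixes A :: "real ^ 'n ^ 'n" and B :: "real ^ 'm ^ 'n" and C :: "real ^ 'n ^ 'p"
    and S :: "real ^ 'v ^ 'v" and L :: "real ^ 'v ^ 'm"
    and P :: "real ^ 'v ^ 'n" and C\<^sub>V :: "real ^ 'v ^ 'p"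
    and G :: "real ^ 'm ^ 'v"
    and M W :: "real ^ ('n + 'v) ^ ('n + 'v)"
  assumes "minimal_realization A B C"
    and "spectrum A \<subseteq> \<complex>\<^sup>-"
    and "observable L S"
    and "spectrum S \<inter> spectrum A = {}"
    and "A ** P + B ** L = P ** S"
    and "C\<^sub>V = C ** P"
    and "is_arg_min (objective A B C S L C\<^sub>V) (\<lambda>G. G \<in> D_SL S L) G"
    and "M = gramian_M A C S L C\<^sub>V G"
    and "err_A A S L G ** W + W ** transpose (err_A A S L G)
           + block_col B G ** transpose (block_col B G) = 0"
  shows "transpose (block12 M) ** block12 W ** transpose L + block22 M ** block22 W ** transpose L
         = transpose (block12 M) ** B + block22 M ** G"
proof -
  define Q where "Q = block_mat (transpose C ** C) (- (transpose C ** C\<^sub>V))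
    (- (transpose C\<^sub>V ** C)) (transpose C\<^sub>V ** C\<^sub>V)"
  define F where "F = err_A A S L G"
  define b where "b = block_col B G"
  let ?J = "inr_mat :: real ^ 'v ^ ('n + 'v)"
  note W = assms(9)[folded F_def b_def]
  have G: "G \<in> D_SL S L"
    using assms(7) by (simp add: is_arg_min_def)
  have min: "objective A B C S L C\<^sub>V G \<le> objective A B C S L C\<^sub>V G'" if "G' \<in> D_SL S L" for G'
    using assms(7) that by (auto simp: is_arg_min_def not_less)
  have stable: "spectrum (err_A A S L G') \<subseteq> \<complex>\<^sup>-" if "G' \<in> D_SL S L" for G'
    using that assms(2) spectrum_block_diag[of A "S - G' ** L"]
    unfolding D_SL_def err_A_def by blast
  have gramian: "transpose (err_A A S L G') ** gramian_M A C S L C\<^sub>V G'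
      + gramian_M A C S L C\<^sub>V G' ** err_A A S L G' + Q = 0" if "G' \<in> D_SL S L" for G'
    unfolding gramian_M_def Q_def[symmetric]
    by (rule theI'[OF lyapunov_stable_solution_unique[OF stable[OF that]]])
  note F = stable[OF G, folded F_def]
  note M = gramian[OF G, folded F_def assms(8)]
  have Q_sym: "transpose Q = Q"
    by (simp add: Q_def transpose_block_mat transpose_simps)
  have M_sym: "transpose M = M"
    by (rule lyapunov_symmetric[OF F M Q_sym])
  \<comment> \<open>The equation for W is the Lyapunov equation with \<open>transpose F\<close> in
    the place of F.\<close>
  have W_sym: "transpose W = W"
    by (rule lyapunov_symmetric[of "transpose F" _ "b ** transpose b"])
      (use F W in \<open>simp_all add: spectrum_transpose transpose_simps\<close>)
  \<comment> \<open>In matrix form this is half the gradient of the objective at G, so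
    \<open>D = - R\<close> points in the direction of steepest descent.\<close>
  define R where "R = transpose ?J ** M ** b - transpose ?J ** M ** (W ** ?J) ** transpose L"
  define D where "D = - R"
  define E where "E = - (?J ** (D ** L) ** transpose ?J)"
  \<comment> \<open>Stability is an open condition, so G + t D remains feasible for small t > 0 and
    minimality applies to it.\<close>
  have "\<forall>\<^sub>F t in at_right 0. spectrum (S - G ** L + t *\<^sub>R (- (D ** L))) \<subseteq> \<complex>\<^sup>-"
    using G by (intro stable_perturbation) (simp add: D_SL_def)
  then have near: "\<forall>\<^sub>F t in at_right 0. G + t *\<^sub>R D \<in> D_SL S L"
    by (rule eventually_mono) (simp add: D_SL_def matrix_distrib diff_diff_add)
  have F_eq: "err_A A S L (G + t *\<^sub>R D) = F + t *\<^sub>R E" for t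
    unfolding F_def E_def by (rule err_A_perturb)
  have b_eq: "block_col B (G + t *\<^sub>R D) = b + t *\<^sub>R (?J ** D)" for t
    unfolding b_def by (rule block_col_perturb)
  have "0 \<le> trace (M ** (E ** W + W ** transpose E + ?J ** D ** transpose b
      + b ** transpose (?J ** D)))"
  proof (rule trace_lyapunov_first_order[OF F W M])
    show "\<forall>\<^sub>F t in at_right 0. transpose (F + t *\<^sub>R E) ** gramian_M A C S L C\<^sub>V (G + t *\<^sub>R D)
        + gramian_M A C S L C\<^sub>V (G + t *\<^sub>R D) ** (F + t *\<^sub>R E) + Q = 0"
      using near by (rule eventually_mono) (use gramian F_eq in metis)
    show "\<forall>\<^sub>F t in at_right 0. trace (transpose b ** M ** b)
        \<le> trace (transpose (b + t *\<^sub>R (?J ** D)) ** gramian_M A C S L C\<^sub>V (G + t *\<^sub>R D)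
          ** (b + t *\<^sub>R (?J ** D)))"
      using near
    proof (rule eventually_mono)
      fix t
      assume "G + t *\<^sub>R D \<in> D_SL S L"
      from min[OF this] show "trace (transpose b ** M ** b)
        \<le> trace (transpose (b + t *\<^sub>R (?J ** D)) ** gramian_M A C S L C\<^sub>V (G + t *\<^sub>R D)
          ** (b + t *\<^sub>R (?J ** D)))"
        unfolding objective_def b_eq by (simp only: assms(8) b_def)
    qed
  qed
  then have "0 \<le> trace (M ** E ** W) + trace (M ** (?J ** D) ** transpose b)"
    unfolding trace_symmetric_gradient[OF M_sym W_sym] by simp
  \<comment> \<open>Cyclic rotation brings D to the front of both traces; what follows D then
    combines to the transpose of R.\<close>
  also have "trace (M ** E ** W) = - trace (D ** (L ** transpose ?J ** W ** M ** ?J))"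
    using trace_mul_sym[of "M ** ?J" "D ** L ** transpose ?J ** W"]
    by (simp add: E_def matrix_distrib trace_uminus matrix_mul_assoc)
  also have "trace (M ** (?J ** D) ** transpose b) = trace (D ** (transpose b ** M ** ?J))"
    using trace_mul_sym[of "M ** ?J" "D ** transpose b"] by (simp add: matrix_mul_assoc)
  also have "- trace (D ** (L ** transpose ?J ** W ** M ** ?J)) + trace (D ** (transpose b ** M ** ?J))
      = trace (D ** transpose R)"
    by (simp add: R_def transpose_simps M_sym W_sym matrix_distrib trace_sub matrix_mul_assoc)
  also have "\<dots> = - (norm R)\<^sup>2"
    by (simp add: D_def matrix_uminus_left trace_uminus trace_mult_transpose_self)
  finally have "R = 0"
    by simp
  then show ?thesis
    \<comment> \<open>The block formula for M serves twice: for the stacked column of B and G, and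
      for the second block column of W.\<close>
    unfolding R_def b_def mult_inr_mat inr_mat_symmetric_mult[OF M_sym]
    by (simp add: matrix_add_rdistrib)
qed

end
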